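(* For every integer $s\ge2$ there exists a constant $C=C(s)>0$, depending only on $s$, such that the following holds. Let $\Delta>0$, $\rho\ge0$, $\ell$ an integer with $2\le\ell\le s$, and $\tau$ with $\ell-1\le\tau<\pi/\Delta$ be such that $4\tau\Delta\le\min\left(\rho,\frac{1}{s^2}\right)$. Let $\boldsymbol{\xi}=(\xi_1,\dots,\xi_s)$ be any vector with all $\xi_j\in\frac{1}{s^2}\left(-\frac{\pi}{2},\frac{\pi}{2}\right]$ forming a $(\Delta,\rho,s,\ell,\tau)$-clustered configuration, and let $N\in\mathbb{N}$ be any integer satisfying $$\max\left(\frac{4\pi s}{\rho},4s^3\right)\le N\le\frac{\pi s}{\tau\Delta}.$$ Then $$\sigma_{\min}\left(\mathbf{V}_N(\boldsymbol{\xi})\right)\ge C\cdot(N\Delta)^{\ell-1}.$$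
   Context: Wrap-around distance: for $t\in\mathbb{R}$, $\|t\|_{\mathbb{T}}:=|\operatorname{Arg}\exp(\imath t)|=|t \bmod (-\pi,\pi]|$, where $\operatorname{Arg}$ takes values in $(-\pi,\pi]$. Clustered configuration: let $\Delta>0$, $2\le\ell\le s$, $\ell-1\le\tau<\pi/\Delta$, $\rho\ge 0$. A vector $\boldsymbol{x}=(t_1,\dots,t_s)$ of $s$ distinct nodes in $(-\frac{\pi}{2},\frac{\pi}{2}]$ forms a $(\Delta,\rho,s,\ell,\tau)$-clustered configuration if for each $t_j$ there exist at most $\ell$ distinct nodes $\boldsymbol{x}^{(j)}=\{t_{j,k}\}_{k=1,\dots,r_j}\subset\boldsymbol{x}$, $1\le r_j\le \ell$, $t_{j,1}\equiv t_j$, such that: (1) for any $y\in\boldsymbol{x}^{(j)}\setminus\{t_j\}$, $\Delta\le\|y-t_j\|_{\mathbb{T}}\le\tau\Delta$; (2) for any $y\in\boldsymbol{x}\setminus\boldsymbol{x}^{(j)}$, $\|y-t_j\|_{\mathbb{T}}\ge\rho$. $\mathbf{V}_N(\boldsymbol{\xi})$ is the $(2N+1)\times s$ matrix $\frac{1}{\sqrt{2N}}\left[\exp(\imath k\xi_j)\right]_{k=-N,\dots,N}^{j=1,\dots,s}$ (row index $k$, column index $j$). $\sigma_{\min}(\mathbf{V}):=\sqrt{\lambda_{\min}(\mathbf{V}^H\mathbf{V})}$, with $\lambda_{\min}$ the minimal eigenvalue. *)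

theory Defs
  imports
    Complex_Main
    "Jordan_Normal_Form.Schur_Decomposition"
    "Jordan_Normal_Form.Char_Poly"
begin

(* Arg is the principal argument, with values in (-pi, pi]. *)
definition wrap_norm :: "real \<Rightarrow> real" where
  "wrap_norm t = \<bar>Arg (exp (\<i> * complex_of_real t))\<bar>"

(* A node vector (t_1, ..., t_s) is a list of length s. The set Y is the set of nodes x^(j)
   attached to the node t = t_j; it contains t itself. *)
definition clustered_configuration ::
    "real \<Rightarrow> real \<Rightarrow> nat \<Rightarrow> nat \<Rightarrow> real \<Rightarrow> real list \<Rightarrow> bool" where
  "clustered_configuration \<Delta> \<rho> s l \<tau> x \<longleftrightarrow>
     length x = s \<and> distinct x \<and> set x \<subseteq> {- (pi / 2) <.. pi / 2} \<and>
     (\<forall>t \<in> set x. \<exists>Y \<subseteq> set x. t \<in> Y \<and> card Y \<le> l \<and>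
        (\<forall>y \<in> Y - {t}. \<Delta> \<le> wrap_norm (y - t) \<and> wrap_norm (y - t) \<le> \<tau> * \<Delta>) \<and>
        (\<forall>y \<in> set x - Y. wrap_norm (y - t) \<ge> \<rho>))"

(* Row i = 0, ..., 2N carries the frequency k = i - N. *)
definition vandermonde :: "nat \<Rightarrow> real list \<Rightarrow> complex mat" where
  "vandermonde N xi = mat (2 * N + 1) (length xi)
     (\<lambda>(i, j). complex_of_real (1 / sqrt (2 * real N)) *
        exp (\<i> * complex_of_real ((real i - real N) * xi ! j)))"

(* Intended for Hermitian matrices of positive dimension, all of whose eigenvalues are real;
   for those the set below is finite and nonempty. *)
definition lambda_min :: "complex mat \<Rightarrow> real" where
  "lambda_min A = Min {r. eigenvalue A (complex_of_real r)}"

definition sigma_min :: "complex mat \<Rightarrow> real" where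
  "sigma_min V = sqrt (lambda_min (mat_adjoint V * V))"

end

theory Submission
  imports
    Defs
    "HOL-Analysis.L2_Norm"
    "Jordan_Normal_Form.Spectral_Radius"
begin

text \<open>
  Write the image of a vector \<open>v\<close> under the Vandermonde matrix as samples
  \<open>u\<^sub>0, \<dots>, u\<^sub>2\<^sub>N\<close> of the exponential sum \<open>u\<^sub>k = (\<Sum>j. c\<^sub>j z\<^sub>j\<^sup>k)\<close> with unimodular
  \<open>z\<^sub>j = exp (i \<xi>\<^sub>j)\<close> and \<open>\<bar>c\<^sub>j\<bar> = \<bar>v\<^sub>j\<bar> / sqrt (2N)\<close>. A lower bound for \<open>\<sigma>\<^sub>m\<^sub>i\<^sub>n\<close> amounts to
  recovering every coefficient from \<open>u\<close> with controlled amplification of the \<open>l\<^sup>2\<close> norm.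

  To recover \<open>c\<^sub>t\<close>, remove the other nodes one at a time. The operator sending \<open>u\<^sub>k\<close> to
  \<open>(u\<^sub>k\<^sub>+\<^sub>m - z\<^sub>y\<^sup>m u\<^sub>k) / 2\<close> annihilates the node \<open>y\<close>, multiplies the coefficient of the node
  \<open>t\<close> by \<open>(z\<^sub>t\<^sup>m - z\<^sub>y\<^sup>m) / 2\<close>, shortens the window of samples by \<open>m\<close> and does not
  increase its \<open>l\<^sup>2\<close> norm. If the steps \<open>m\<^sub>y\<close> add up to at most \<open>N\<close>, then more than \<open>N\<close>
  samples of a single exponential of modulus \<open>\<bar>c\<^sub>t\<bar> (\<Prod>y. \<bar>z\<^sub>t\<^sup>m - z\<^sub>y\<^sup>m\<bar> / 2)\<close> are left, and
  their \<open>l\<^sup>2\<close> norm supplies a factor \<open>sqrt N\<close> that balances the normalisation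
  \<open>1 / sqrt (2N)\<close> (\<open>isolate_exponential\<close>, \<open>coordinate_bound\<close>).

  Giving each node a step of at most \<open>N / s\<close> respects this budget. For a node \<open>y\<close> in the
  cluster of \<open>t\<close>, at distance \<open>d\<close> between \<open>\<Delta>\<close> and \<open>\<tau>\<Delta>\<close>, the largest step
  \<open>N div s\<close> turns by an angle that \<open>N \<le> \<pi>s / (\<tau>\<Delta>)\<close> keeps below \<open>\<pi>\<close>, so the factor is
  of order \<open>Nd / s \<ge> N\<Delta> / s\<close> (\<open>near_pair_gap\<close>). For a node outside the cluster,
  \<open>d \<ge> \<rho> \<ge> 4\<pi>s / N\<close> leaves room for a step that turns by an angle in
  \<open>[\<pi>/2, \<pi>]\<close>, so the factor is at least \<open>1/2\<close> (\<open>far_pair_gap\<close>). At most \<open>l - 1\<close> nodes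
  are of the first kind, which gives the exponent \<open>l - 1\<close>.
\<close>

section \<open>The least singular value as a lower bound for the matrix action\<close>

lemma mult_adjoint_entry:
  assumes V: "V \<in> carrier_mat m n" and w: "w \<in> carrier_vec m" and i: "i < n"
  shows "(mat_adjoint V *\<^sub>v w) $ i = (\<Sum>k<m. cnj (V $$ (k, i)) * w $ k)"
proof -
  have "(mat_adjoint V *\<^sub>v w) $ i = conjugate (col V i) \<bullet> w"
    using V i by (simp add: mat_adjoint_def)
  also have "\<dots> = (\<Sum>k<m. cnj (V $$ (k, i)) * w $ k)"
    using V w i by (simp add: scalar_prod_def lessThan_atLeast0)
  finally show ?thesis .
qed

text \<open>
  The identity \<open>\<langle>V\<^sup>HVv, v\<rangle> = \<langle>Vv, Vv\<rangle>\<close> evaluated at an eigenvector. The eigenvalue is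
  allowed to be complex: the identity is also what shows that it is real.
\<close>

lemma gram_eigenvector_rayleigh:
  assumes V: "V \<in> carrier_mat m n" and v: "v \<in> carrier_vec n"
    and eig: "(mat_adjoint V * V) *\<^sub>v v = e \<cdot>\<^sub>v v"
  shows "e * complex_of_real (\<Sum>i<n. (cmod (v $ i))\<^sup>2)
           = complex_of_real (\<Sum>k<m. (cmod ((V *\<^sub>v v) $ k))\<^sup>2)"
proof -
  define w where "w = V *\<^sub>v v"
  have w: "w \<in> carrier_vec m" using V v by (simp add: w_def)
  have adj: "mat_adjoint V \<in> carrier_mat n m"
    using V by (auto simp: mat_adjoint_def)
  have entry: "e * v $ i = (\<Sum>k<m. cnj (V $$ (k, i)) * w $ k)" if "i < n" for i
  proof -
    have "(mat_adjoint V *\<^sub>v w) $ i = (e \<cdot>\<^sub>v v) $ i"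
      using eig assoc_mult_mat_vec[OF adj V v] by (simp add: w_def)
    with mult_adjoint_entry[OF V w that] show ?thesis using v that by simp
  qed
  have wk: "w $ k = (\<Sum>i<n. V $$ (k, i) * v $ i)" if "k < m" for k
    using V v that by (simp add: w_def scalar_prod_def lessThan_atLeast0)
  have "e * complex_of_real (\<Sum>i<n. (cmod (v $ i))\<^sup>2) = (\<Sum>i<n. (e * v $ i) * cnj (v $ i))"
    by (simp add: sum_distrib_left complex_norm_square mult.assoc del: of_real_power)
  also have "\<dots> = (\<Sum>i<n. \<Sum>k<m. cnj (V $$ (k, i)) * w $ k * cnj (v $ i))"
    by (simp add: entry sum_distrib_right)
  also have "\<dots> = (\<Sum>k<m. \<Sum>i<n. cnj (V $$ (k, i)) * w $ k * cnj (v $ i))"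
    by (rule sum.swap)
  also have "\<dots> = (\<Sum>k<m. w $ k * cnj (w $ k))"
  proof (rule sum.cong[OF refl])
    fix k assume "k \<in> {..<m}"
    then have "cnj (w $ k) = (\<Sum>i<n. cnj (V $$ (k, i)) * cnj (v $ i))"
      by (simp add: wk)
    then show "(\<Sum>i<n. cnj (V $$ (k, i)) * w $ k * cnj (v $ i)) = w $ k * cnj (w $ k)"
      by (simp add: sum_distrib_left mult_ac)
  qed
  also have "\<dots> = complex_of_real (\<Sum>k<m. (cmod (w $ k))\<^sup>2)"
    by (simp add: complex_norm_square del: of_real_power)
  finally show ?thesis by (simp add: w_def)
qed

text \<open>
  Since the minimum in \<^const>\<open>lambda_min\<close> runs over real eigenvalues, it has to be
  known that there are finitely many and at least one before it can be compared with
  a Rayleigh quotient. Existence comes from the complex spectrum, all of which is real.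
\<close>

lemma sigma_min_ge:
  assumes V: "V \<in> carrier_mat m n" and "n > 0" and "K \<ge> 0"
    and bound: "\<And>v. v \<in> carrier_vec n \<Longrightarrow>
      K * L2_set (\<lambda>i. cmod (v $ i)) {..<n} \<le> L2_set (\<lambda>k. cmod ((V *\<^sub>v v) $ k)) {..<m}"
  shows "K \<le> sigma_min V"
proof -
  define G where "G = mat_adjoint V * V"
  have G: "G \<in> carrier_mat n n"
    using V by (auto simp: G_def mat_adjoint_def)
  have rayleigh: "\<exists>r. e = complex_of_real r \<and> K\<^sup>2 \<le> r" if eig: "eigenvalue G e" for e
  proof -
    obtain v where "eigenvector G v e"
      using eig by (auto simp: eigenvalue_def)
    then have v: "v \<in> carrier_vec n" "v \<noteq> 0\<^sub>v n" "G *\<^sub>v v = e \<cdot>\<^sub>v v"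
      using carrier_matD(1)[OF G] by (simp_all add: eigenvector_def)
    define a where "a = (\<Sum>i<n. (cmod (v $ i))\<^sup>2)"
    define b where "b = (\<Sum>k<m. (cmod ((V *\<^sub>v v) $ k))\<^sup>2)"
    have eab: "e * complex_of_real a = complex_of_real b"
      unfolding a_def b_def using gram_eigenvector_rayleigh[OF V v(1)] v(3) by (simp add: G_def)
    obtain i where i: "i < n" "v $ i \<noteq> 0"
      using v(1,2) by (metis eq_vecI carrier_vecD index_zero_vec)
    have apos: "a > 0"
      unfolding a_def by (rule sum_pos2[of _ i]) (use i in auto)
    have "K * sqrt a \<le> sqrt b"
      using bound[OF v(1)] by (simp add: L2_set_def a_def b_def)
    then have "(K * sqrt a)\<^sup>2 \<le> (sqrt b)\<^sup>2"
      using \<open>K \<ge> 0\<close> apos by (intro power_mono) auto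
    moreover have "b \<ge> 0" by (auto simp: b_def intro: sum_nonneg)
    ultimately have "K\<^sup>2 * a \<le> b" using apos by (simp add: power_mult_distrib)
    then have "K\<^sup>2 \<le> b / a" using apos by (simp add: pos_le_divide_eq)
    moreover have "e = complex_of_real (b / a)"
      using eab apos by (simp add: field_simps)
    ultimately show ?thesis by blast
  qed
  define R where "R = {r. eigenvalue G (complex_of_real r)}"
  have "spectrum G \<noteq> {}" using spectrum_non_empty[OF G \<open>n > 0\<close>] .
  then have "R \<noteq> {}" using rayleigh unfolding R_def spectrum_def by blast
  have "finite (complex_of_real ` R)"
    by (rule finite_subset[OF _ card_finite_spectrum(1)[OF G]]) (auto simp: R_def spectrum_def)
  then have "finite R"
    by (rule finite_imageD) (simp add: inj_on_def)
  then have "Min R \<in> R" using \<open>R \<noteq> {}\<close> by (rule Min_in)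
  then have "K\<^sup>2 \<le> Min R" using rayleigh[of "complex_of_real (Min R)"] by (auto simp: R_def)
  then show ?thesis
    unfolding sigma_min_def lambda_min_def G_def[symmetric] R_def[symmetric]
    by (rule real_le_rsqrt)
qed

section \<open>Isolating one exponential by differences\<close>

lemma L2_set_shift_le:
  fixes f :: "nat \<Rightarrow> real"
  shows "L2_set (\<lambda>k. f (k + m)) {..<L} \<le> L2_set f {..<L + m}"
proof -
  have "(\<Sum>k<L. (f (k + m))\<^sup>2) = (\<Sum>k\<in>(\<lambda>k. k + m) ` {..<L}. (f k)\<^sup>2)"
    by (subst sum.reindex) auto
  also have "\<dots> \<le> (\<Sum>k<L + m. (f k)\<^sup>2)"
    by (rule sum_mono2) auto
  finally show ?thesis by (simp add: L2_set_def)
qed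

text \<open>
  Each induction step applies the operator that annihilates the node \<open>y\<close>. Dividing it by 2
  makes it a contraction from the longer window to the shorter one, by the triangle
  inequality. The remaining sum is again an exponential sum, with modified coefficients,
  which is why the induction generalises over \<open>c\<close>. When all other nodes are gone, the
  window contains \<open>L\<close> terms of modulus \<open>\<bar>c\<^sub>t\<bar>\<close>.
\<close>

lemma isolate_exponential:
  fixes z c :: "'a \<Rightarrow> complex" and m :: "'a \<Rightarrow> nat"
  assumes "finite T" "t \<notin> T" "cmod (z t) = 1" "\<And>y. y \<in> T \<Longrightarrow> cmod (z y) = 1"
  shows "(\<Prod>y\<in>T. cmod (z t ^ m y - z y ^ m y) / 2) * (cmod (c t) * sqrt (real L))
    \<le> L2_set (\<lambda>k. cmod (\<Sum>j\<in>insert t T. c j * z j ^ k)) {..<L + sum m T}"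
  using assms
proof (induction T arbitrary: c rule: finite_induct)
  case empty
  then show ?case by (simp add: norm_mult norm_power L2_set_constant mult.commute)
next
  case (insert y T)
  define u where "u k = (\<Sum>j\<in>insert t (insert y T). c j * z j ^ k)" for k
  define c' where "c' j = c j * (z j ^ m y - z y ^ m y) / 2" for j
  let ?W = "L + sum m T"
  have step: "(\<Sum>j\<in>insert t T. c' j * z j ^ k) = (u (k + m y) - z y ^ m y * u k) / 2" for k
  proof -
    have "(u (k + m y) - z y ^ m y * u k) / 2 = (\<Sum>j\<in>insert t (insert y T). c' j * z j ^ k)"
      unfolding u_def c'_def
      by (simp add: sum_subtractf[symmetric] sum_distrib_left sum_divide_distrib power_add
          algebra_simps del: sum.insert)
    also have "insert t (insert y T) = insert y (insert t T)" by auto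
    also have "(\<Sum>j\<in>insert y (insert t T). c' j * z j ^ k) = (\<Sum>j\<in>insert t T. c' j * z j ^ k)"
      by (rule sum.mono_neutral_right) (use insert in \<open>auto simp: c'_def\<close>)
    finally show ?thesis by simp
  qed
  have zy: "cmod (z y) = 1" using insert by auto
  have pointwise: "cmod (\<Sum>j\<in>insert t T. c' j * z j ^ k) \<le> 1/2 * (cmod (u (k + m y)) + cmod (u k))" for k
    using norm_triangle_ineq4[of "u (k + m y)" "z y ^ m y * u k"]
    unfolding step by (simp add: norm_divide norm_mult norm_power zy)
  have "(\<Prod>y\<in>insert y T. cmod (z t ^ m y - z y ^ m y) / 2) * (cmod (c t) * sqrt (real L))
     = (\<Prod>y\<in>T. cmod (z t ^ m y - z y ^ m y) / 2) * (cmod (c' t) * sqrt (real L))"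
    using insert by (simp add: c'_def norm_mult norm_divide mult_ac)
  also have "\<dots> \<le> L2_set (\<lambda>k. cmod (\<Sum>j\<in>insert t T. c' j * z j ^ k)) {..<?W}"
    using insert by (intro insert.IH) auto
  also have "\<dots> \<le> L2_set (\<lambda>k. 1/2 * (cmod (u (k + m y)) + cmod (u k))) {..<?W}"
    by (rule L2_set_mono) (use pointwise in auto)
  also have "\<dots> = 1/2 * L2_set (\<lambda>k. cmod (u (k + m y)) + cmod (u k)) {..<?W}"
    by (rule L2_set_right_distrib[symmetric]) simp
  also have "\<dots> \<le> 1/2 * (L2_set (\<lambda>k. cmod (u (k + m y))) {..<?W} + L2_set (\<lambda>k. cmod (u k)) {..<?W})"
    by (intro mult_left_mono L2_set_triangle_ineq) simp
  also have "\<dots> \<le> L2_set (\<lambda>k. cmod (u k)) {..<?W + m y}"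
  proof -
    have "L2_set (\<lambda>k. cmod (u k)) {..<?W} \<le> L2_set (\<lambda>k. cmod (u k)) {..<?W + m y}"
      unfolding L2_set_def by (intro real_sqrt_le_mono sum_mono2) auto
    with L2_set_shift_le[of "\<lambda>k. cmod (u k)" "m y" ?W] show ?thesis by simp
  qed
  finally show ?case
    using insert by (simp add: u_def add_ac)
qed

section \<open>Choosing the steps\<close>

lemma cmod_cis_power_diff:
  "cmod (cis a ^ m - cis b ^ m) = cmod (cis (real m * \<bar>a - b\<bar>) - 1)"
proof -
  have reduce: "cmod (cis x ^ m - cis y ^ m) = cmod (cis (real m * (x - y)) - 1)" for x y
  proof -
    have "cis x ^ m - cis y ^ m = cis (real m * y) * (cis (real m * (x - y)) - 1)"
      by (simp add: DeMoivre cis_mult algebra_simps)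
    then show ?thesis by (simp add: norm_mult)
  qed
  show ?thesis
    using reduce[of a b] reduce[of b a] by (cases "a \<le> b") (simp_all add: norm_minus_commute)
qed

text \<open>
  The chord has length \<open>2 sin (x/2)\<close>, and \<open>sin y \<ge> y - y\<^sup>3/6 \<ge> y/3\<close> for
  \<open>0 \<le> y \<le> 2\<close>. The optimal constant is \<open>2/\<pi>\<close>, but the crude one suffices here.
\<close>

lemma cmod_cis_minus_one_ge:
  assumes "0 \<le> x" "x \<le> pi"
  shows "x / 3 \<le> cmod (cis x - 1)"
proof -
  define y where "y = x / 2"
  have y: "0 \<le> y" "y \<le> 2" using assms pi_less_4 by (auto simp: y_def)
  have "\<bar>sin y - (\<Sum>k<3. sin_coeff k * y ^ k)\<bar> \<le> inverse (fact 3) * \<bar>y\<bar> ^ 3"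
    by (rule Maclaurin_sin_bound)
  moreover have "(\<Sum>k<3. sin_coeff k * y ^ k) = y"
    by (simp add: sin_coeff_def numeral_3_eq_3)
  moreover have "inverse (fact 3) * \<bar>y\<bar> ^ 3 = y ^ 3 / 6"
    using y by (simp add: fact_numeral)
  ultimately have s: "sin y \<ge> y - y ^ 3 / 6" by linarith
  have "y * y \<le> 2 * 2" using y by (intro mult_mono) auto
  then have "y * (y * y) \<le> y * 4" using y by (intro mult_left_mono) auto
  with s have "sin y \<ge> y / 3" by (simp add: power3_eq_cube mult.assoc)
  moreover have "cmod (cis x - 1) = 2 * \<bar>sin y\<bar>"
  proof -
    have "cis x - 1 = cis y * (2 * \<i> * complex_of_real (sin y))"
      by (simp add: complex_eq_iff y_def sin_double[of "x / 2", simplified]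
          cos_double_sin[of "x / 2", simplified] power2_eq_square)
    then show ?thesis by (simp add: norm_mult)
  qed
  ultimately show ?thesis by (simp add: y_def)
qed

text \<open>
  The step \<open>N div s\<close> lies between \<open>N / (2s)\<close> and \<open>N / s\<close>. The upper bound keeps the angle
  in \<open>[0, \<pi>]\<close>, where the chord grows linearly; the lower bound makes the chord at
  least \<open>Nd / (6s)\<close>.
\<close>

lemma near_pair_gap:
  assumes "0 < s" "s \<le> N" "0 \<le> d" "real N * d \<le> pi * real s"
  shows "real N * d / (12 * real s) \<le> cmod (cis (real (N div s) * d) - 1) / 2"
proof -
  let ?m = "N div s"
  have "N \<le> 2 * (?m * s)"
  proof -
    have "s \<le> ?m * s" using assms by (simp add: Suc_le_eq div_greater_zero_iff)
    moreover have "N < s + ?m * s"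
      using assms by (metis mod_less_divisor mod_mult_div_eq add_less_cancel_right mult.commute)
    ultimately show ?thesis by linarith
  qed
  then have N: "real N \<le> 2 * (real ?m * real s)" by (metis of_nat_le_iff of_nat_mult of_nat_numeral)
  have "real ?m * real s \<le> real N" 
    by (metis div_times_less_eq_dividend of_nat_le_iff of_nat_mult)
  then have "real ?m * real s * d \<le> pi * real s"
    using assms mult_right_mono[of "real ?m * real s" "real N" d] by linarith
  then have "real ?m * d \<le> pi" using \<open>0 < s\<close> by (simp add: mult.commute mult.left_commute)
  then have "real ?m * d / 3 \<le> cmod (cis (real ?m * d) - 1)"
    using assms by (intro cmod_cis_minus_one_ge) auto
  moreover have "real N * d / (12 * real s) \<le> real ?m * d / 6"
    using mult_right_mono[OF N \<open>0 \<le> d\<close>] assms by (simp add: field_simps)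
  ultimately show ?thesis by linarith
qed

text \<open>
  The step is the first multiple of \<open>d\<close> to reach the angle \<open>\<pi>/2\<close>. As \<open>d \<le> \<pi>/2\<close>, it does
  not pass \<open>\<pi>\<close>, so the real parts of the two points on the circle differ by at least 1.
  The lower bound on \<open>Nd\<close> makes the step small enough for the budget \<open>N / s\<close>.
\<close>

lemma far_pair_gap:
  assumes "0 < s" "2 * s \<le> N" "d \<le> pi / 2" "4 * pi * real s \<le> real N * d"
  obtains m where "m * s \<le> N" "1 / 2 \<le> cmod (cis (real m * d) - 1) / 2"
proof
  define m where "m = nat \<lceil>pi / (2 * d)\<rceil>"
  have "0 < real N * d" using assms by (intro less_le_trans[OF _ assms(4)]) simp
  then have d: "d > 0" using assms by (simp add: zero_less_mult_iff)
  have "0 \<le> pi / (2 * d)" using d by simp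
  then have m: "pi / (2 * d) \<le> real m" "real m \<le> pi / (2 * d) + 1"
    unfolding m_def by linarith+
  have "real m * real s \<le> (pi / (2 * d) + 1) * real s"
    using m by (intro mult_right_mono) auto
  also have "\<dots> = pi * real s / (2 * d) + real s" by (simp add: algebra_simps)
  also have "pi * real s / (2 * d) \<le> real N / 8"
    using assms d by (simp add: field_simps)
  finally have "real m * real s \<le> real N" using assms by linarith
  then show "m * s \<le> N" by (metis of_nat_le_iff of_nat_mult)
  have "pi / 2 \<le> real m * d" "real m * d \<le> pi / 2 + d"
    using m d by (simp_all add: field_simps)
  moreover have "pi / 2 + d \<le> pi" using assms by simp
  ultimately have "cos (real m * d) \<le> cos (pi / 2)"
    using pi_gt_zero by (intro cos_monotone_0_pi_le) linarith+
  then have "1 \<le> \<bar>Re (cis (real m * d) - 1)\<bar>" by simp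
  then have "1 \<le> cmod (cis (real m * d) - 1)" using abs_Re_le_cmod order_trans by blast
  then show "1 / 2 \<le> cmod (cis (real m * d) - 1) / 2" by simp
qed

lemma wrap_norm_eq_abs:
  assumes "\<bar>u\<bar> < pi" shows "wrap_norm u = \<bar>u\<bar>"
proof -
  have "Arg (cis u) = u"
    by (rule cis_Arg_unique) (use assms in \<open>auto simp: sgn_eq\<close>)
  then show ?thesis by (simp add: wrap_norm_def cis_conv_exp)
qed

text \<open>
  Since \<open>p\<close> and \<open>q\<close> do not exceed 1, upper bounds on the numbers of factors are enough:
  a cluster with fewer than \<open>l\<close> nodes only improves the estimate.
\<close>

lemma prod_ge_split:
  fixes f :: "'a \<Rightarrow> real"
  assumes "finite A" "finite B" "A \<inter> B = {}" "card A \<le> a" "card B \<le> b"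
    and "0 < p" "p \<le> 1" "0 < q" "q \<le> 1"
    and "\<And>x. x \<in> A \<Longrightarrow> p \<le> f x" "\<And>x. x \<in> B \<Longrightarrow> q \<le> f x"
  shows "p ^ a * q ^ b \<le> prod f (A \<union> B)"
proof -
  have "p ^ a \<le> p ^ card A" "q ^ b \<le> q ^ card B"
    using assms by (auto intro: power_decreasing)
  moreover have "p ^ card A \<le> prod f A"
    using prod_mono[of A "\<lambda>_. p" f] assms by simp
  moreover have "q ^ card B \<le> prod f B"
    using prod_mono[of B "\<lambda>_. q" f] assms by simp
  ultimately have "p ^ a * q ^ b \<le> prod f A * prod f B"
    using assms by (intro mult_mono prod_nonneg) (auto intro: order_trans less_imp_le)
  also have "\<dots> = prod f (A \<union> B)" using assms by (intro prod.union_disjoint[symmetric])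
  finally show ?thesis .
qed

lemma sum_shifts_le:
  fixes m :: "'a \<Rightarrow> nat"
  assumes "0 < s" "card T \<le> s" "\<And>y. y \<in> T \<Longrightarrow> m y * s \<le> N"
  shows "sum m T \<le> N"
proof -
  have "sum m T * s \<le> card T * N"
    unfolding sum_distrib_right using sum_bounded_above[of T "\<lambda>y. m y * s" N] assms by simp
  also have "\<dots> \<le> s * N" using assms by (intro mult_right_mono) auto
  finally show ?thesis using assms by (simp add: mult.commute)
qed

section \<open>From the steps to the singular value\<close>

text \<open>
  Row \<open>k\<close> carries the frequency \<open>k - N\<close>. Moving the factor \<open>exp (-i N \<xi>\<^sub>j)\<close>, of modulus 1,
  into the coefficient leaves an exponential sum over natural frequencies.
\<close>

lemma vandermonde_mult_entry:
  assumes "v \<in> carrier_vec (length xi)" "k < 2 * N + 1"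
  shows "(vandermonde N xi *\<^sub>v v) $ k =
    (\<Sum>j<length xi. (v $ j * cis (- (real N * xi ! j)) / complex_of_real (sqrt (2 * real N)))
        * cis (xi ! j) ^ k)"
proof -
  have e: "exp (\<i> * complex_of_real ((real k - real N) * x)) = cis (- (real N * x)) * cis x ^ k" for x
    unfolding cis_conv_exp[symmetric] by (simp add: DeMoivre cis_mult algebra_simps)
  have "(vandermonde N xi *\<^sub>v v) $ k =
    (\<Sum>j<length xi. complex_of_real (1 / sqrt (2 * real N)) *
        exp (\<i> * complex_of_real ((real k - real N) * xi ! j)) * v $ j)"
    using assms by (simp add: vandermonde_def scalar_prod_def lessThan_atLeast0)
  also have "\<dots> = (\<Sum>j<length xi. (v $ j * cis (- (real N * xi ! j)) / complex_of_real (sqrt (2 * real N)))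
        * cis (xi ! j) ^ k)"
    by (intro sum.cong refl) (simp only: e, simp)
  finally show ?thesis .
qed

lemma coordinate_bound:
  assumes xi: "length xi = s" "t < s" and s: "0 < s" and N: "0 < N"
    and m: "\<And>y. y \<in> {..<s} - {t} \<Longrightarrow> m y * s \<le> N"
    and P: "0 \<le> P" "P \<le> (\<Prod>y\<in>{..<s} - {t}. cmod (cis (real (m y) * \<bar>xi ! t - xi ! y\<bar>) - 1) / 2)"
    and v: "v \<in> carrier_vec s"
  shows "P * cmod (v $ t) \<le> sqrt 2 * L2_set (\<lambda>k. cmod ((vandermonde N xi *\<^sub>v v) $ k)) {..<2 * N + 1}"
proof -
  let ?T = "{..<s} - {t}"
  define z where "z j = cis (xi ! j)" for j
  define c where "c j = v $ j * cis (- (real N * xi ! j)) / complex_of_real (sqrt (2 * real N))" for j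
  have "sum m ?T \<le> N" using s m card_mono[of "{..<s}" ?T] by (intro sum_shifts_le[of s]) auto
  then have L: "2 * N + 1 - sum m ?T + sum m ?T = 2 * N + 1" "N \<le> 2 * N + 1 - sum m ?T" by auto
  have T: "insert t ?T = {..<s}" using xi by auto
  \<comment> \<open>More than \<open>N\<close> samples survive all the steps; keeping \<open>N\<close> of them gives the factor \<open>sqrt N\<close>.\<close>
  have "P * (cmod (c t) * sqrt (real N)) \<le>
     (\<Prod>y\<in>?T. cmod (z t ^ m y - z y ^ m y) / 2) * (cmod (c t) * sqrt (real (2 * N + 1 - sum m ?T)))"
    using P L(2) by (intro mult_mono) (auto simp: z_def cmod_cis_power_diff prod_nonneg)
  also have "\<dots> \<le> L2_set (\<lambda>k. cmod (\<Sum>j<s. c j * z j ^ k)) {..<2 * N + 1}"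
    using isolate_exponential[of ?T t z m c "2 * N + 1 - sum m ?T"] unfolding L(1) T
    by (simp add: z_def)
  also have "\<dots> = L2_set (\<lambda>k. cmod ((vandermonde N xi *\<^sub>v v) $ k)) {..<2 * N + 1}"
    using v xi by (intro L2_set_cong refl) (simp add: vandermonde_mult_entry c_def z_def)
  finally have *: "P * (cmod (c t) * sqrt (real N))
    \<le> L2_set (\<lambda>k. cmod ((vandermonde N xi *\<^sub>v v) $ k)) {..<2 * N + 1}" .
  have "sqrt 2 * (cmod (c t) * sqrt (real N)) = cmod (v $ t)"
    using N by (simp add: c_def norm_mult norm_divide real_sqrt_mult)
  then have "P * cmod (v $ t) = sqrt 2 * (P * (cmod (c t) * sqrt (real N)))" by (simp add: mult_ac)
  also have "\<dots> \<le> sqrt 2 * L2_set (\<lambda>k. cmod ((vandermonde N xi *\<^sub>v v) $ k)) {..<2 * N + 1}"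
    using * by (intro mult_left_mono) auto
  finally show ?thesis .
qed

text \<open>
  Adding the bounds for the \<open>s\<close> coordinates costs a factor \<open>sqrt s\<close>; the other \<open>sqrt 2\<close>
  is that of \<open>coordinate_bound\<close>, where the normalisation \<open>1 / sqrt (2N)\<close> meets a factor
  \<open>sqrt N\<close> from the remaining window.
\<close>

lemma sigma_min_vandermonde_ge:
  assumes xi: "length xi = s" and s: "0 < s" and N: "0 < N" and P: "0 \<le> P"
    and shifts: "\<And>t. t < s \<Longrightarrow> \<exists>m. (\<forall>y\<in>{..<s} - {t}. m y * s \<le> N) \<and>
       P \<le> (\<Prod>y\<in>{..<s} - {t}. cmod (cis (real (m y) * \<bar>xi ! t - xi ! y\<bar>) - 1) / 2)"
  shows "P / sqrt (2 * real s) \<le> sigma_min (vandermonde N xi)"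
proof (rule sigma_min_ge[of _ "2 * N + 1" s])
  show "vandermonde N xi \<in> carrier_mat (2 * N + 1) s" using xi by (simp add: vandermonde_def)
  show "0 \<le> P / sqrt (2 * real s)" using P by simp
  fix v :: "complex vec" assume v: "v \<in> carrier_vec s"
  let ?B = "L2_set (\<lambda>k. cmod ((vandermonde N xi *\<^sub>v v) $ k)) {..<2 * N + 1}"
  have "P * L2_set (\<lambda>i. cmod (v $ i)) {..<s} = L2_set (\<lambda>i. P * cmod (v $ i)) {..<s}"
    using P by (rule L2_set_right_distrib)
  also have "\<dots> \<le> L2_set (\<lambda>i. sqrt 2 * ?B) {..<s}"
  proof (rule L2_set_mono)
    fix t assume "t \<in> {..<s}"
    then have t: "t < s" by simp
    obtain m where "\<forall>y\<in>{..<s} - {t}. m y * s \<le> N"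
       "P \<le> (\<Prod>y\<in>{..<s} - {t}. cmod (cis (real (m y) * \<bar>xi ! t - xi ! y\<bar>) - 1) / 2)"
      using shifts[OF t] by blast
    then show "P * cmod (v $ t) \<le> sqrt 2 * ?B"
      using coordinate_bound[OF xi t s N _ P _ v, of m] by blast
  qed (use P in simp)
  also have "\<dots> = sqrt (2 * real s) * ?B"
    by (simp add: L2_set_constant real_sqrt_mult abs_mult)
  finally show "P / sqrt (2 * real s) * L2_set (\<lambda>i. cmod (v $ i)) {..<s} \<le> ?B"
    using s by (simp add: field_simps)
qed (rule s)

section \<open>Clustered configurations\<close>

text \<open>
  Because the nodes lie in an interval of length \<open>\<pi> / s\<^sup>2 \<le> \<pi>/4\<close>, no distance wraps around and
  distances outside the cluster stay below \<open>\<pi>/2\<close>, as the choice of their steps demands.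
  The product over the other nodes splits according to membership in the cluster of \<open>t\<close>.
\<close>

lemma clustered_node_gaps:
  assumes conf: "clustered_configuration \<Delta> \<rho> s l \<tau> xi"
    and small: "set xi \<subseteq> {- (pi / 2) / real s ^ 2 <.. (pi / 2) / real s ^ 2}"
    and s: "2 \<le> s" and pos: "0 < \<Delta>" "0 < \<rho>" "1 \<le> \<tau>"
    and N: "2 * s \<le> N" "4 * pi * real s \<le> real N * \<rho>" "real N * (\<tau> * \<Delta>) \<le> pi * real s"
    and t: "t < s"
  shows "\<exists>m. (\<forall>y\<in>{..<s} - {t}. m y * s \<le> N) \<and>
     (real N * \<Delta> / (12 * real s)) ^ (l - 1) * (1 / 2) ^ s
       \<le> (\<Prod>y\<in>{..<s} - {t}. cmod (cis (real (m y) * \<bar>xi ! t - xi ! y\<bar>) - 1) / 2)"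
proof -
  define d where "d y = \<bar>xi ! t - xi ! y\<bar>" for y
  let ?p = "real N * \<Delta> / (12 * real s)"
  have len: "length xi = s" and dist: "distinct xi"
    using conf by (auto simp: clustered_configuration_def)
  have mem: "xi ! y \<in> set xi" if "y < s" for y using that len by simp
  obtain Y where Y: "Y \<subseteq> set xi" "xi ! t \<in> Y" "card Y \<le> l"
      and near: "\<And>y. y \<in> Y - {xi ! t} \<Longrightarrow> \<Delta> \<le> wrap_norm (y - xi ! t) \<and> wrap_norm (y - xi ! t) \<le> \<tau> * \<Delta>"
      and far: "\<And>y. y \<in> set xi - Y \<Longrightarrow> \<rho> \<le> wrap_norm (y - xi ! t)"
    using conf mem[OF t] unfolding clustered_configuration_def by metis
  have d_le: "d y \<le> pi / 4" if "y < s" for y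
  proof -
    define h where "h = (pi / 2) / real s ^ 2"
    have "2 ^ 2 \<le> real s ^ 2" using s by (intro power_mono) auto
    then have "h \<le> (pi / 2) / 4" using s unfolding h_def by (intro divide_left_mono) auto
    moreover have "- h < xi ! y" "xi ! y \<le> h" "- h < xi ! t" "xi ! t \<le> h"
      using mem[OF that] mem[OF t] small by (auto simp: h_def)
    ultimately show ?thesis unfolding d_def abs_le_iff by linarith
  qed
  have wrap: "wrap_norm (xi ! y - xi ! t) = d y" if "y < s" for y
  proof -
    have d: "d y = \<bar>xi ! y - xi ! t\<bar>" by (simp add: d_def abs_minus_commute)
    moreover have "d y < pi" using d_le[OF that] pi_gt_zero by linarith
    ultimately show ?thesis using wrap_norm_eq_abs by metis
  qed
  define A where "A = {y \<in> {..<s} - {t}. xi ! y \<in> Y}"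
  define B where "B = {y \<in> {..<s} - {t}. xi ! y \<notin> Y}"
  have AB: "{..<s} - {t} = A \<union> B" "A \<inter> B = {}" "finite A" "finite B"
    by (auto simp: A_def B_def)
  have neq: "xi ! y \<noteq> xi ! t" if "y \<in> {..<s} - {t}" for y
    using that dist len t by (simp add: nth_eq_iff_index_eq)
  have "card A \<le> card (Y - {xi ! t})"
  proof (rule card_inj_on_le)
    show "inj_on ((!) xi) A"
      using dist len by (auto simp: inj_on_def A_def nth_eq_iff_index_eq)
    show "(!) xi ` A \<subseteq> Y - {xi ! t}" using neq by (auto simp: A_def)
    show "finite (Y - {xi ! t})" using Y(1) by (simp add: finite_subset)
  qed
  then have cardA: "card A \<le> l - 1" using Y(2,3) by simp
  have cardB: "card B \<le> s"
    using card_mono[of "{..<s}" B] by (auto simp: B_def)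
  have gapA: "?p \<le> cmod (cis (real (N div s) * d y) - 1) / 2" if "y \<in> A" for y
  proof -
    have dy: "\<Delta> \<le> d y" "d y \<le> \<tau> * \<Delta>"
      using near[of "xi ! y"] neq[of y] wrap[of y] that by (auto simp: A_def)
    have "real N * d y \<le> pi * real s"
      using mult_left_mono[OF dy(2), of "real N"] N(3) by linarith
    then have "real N * d y / (12 * real s) \<le> cmod (cis (real (N div s) * d y) - 1) / 2"
      using s N by (intro near_pair_gap) (auto simp: d_def)
    moreover have "?p \<le> real N * d y / (12 * real s)"
      using dy by (intro divide_right_mono mult_left_mono) auto
    ultimately show ?thesis by linarith
  qed
  have "\<exists>m. m * s \<le> N \<and> 1 / 2 \<le> cmod (cis (real m * d y) - 1) / 2" if "y \<in> B" for y
  proof -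
    have y: "y < s" "xi ! y \<in> set xi - Y" using that mem by (auto simp: B_def)
    have "\<rho> \<le> d y" using far[OF y(2)] wrap[OF y(1)] by simp
    then have "4 * pi * real s \<le> real N * d y"
      using N(2) mult_left_mono[of \<rho> "d y" "real N"] by linarith
    moreover have "d y \<le> pi / 2" using d_le[OF y(1)] pi_gt_zero by linarith
    moreover have "0 < s" using s by simp
    ultimately obtain m where "m * s \<le> N" "1 / 2 \<le> cmod (cis (real m * d y) - 1) / 2"
      using far_pair_gap[of s N "d y"] N(1) by blast
    then show ?thesis by blast
  qed
  then obtain mB where mB: "\<And>y. y \<in> B \<Longrightarrow> mB y * s \<le> N \<and> 1 / 2 \<le> cmod (cis (real (mB y) * d y) - 1) / 2"
    by metis
  define m where "m y = (if y \<in> A then N div s else mB y)" for y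
  have budget: "m y * s \<le> N" if "y \<in> {..<s} - {t}" for y
    using that mB AB(1) by (cases "y \<in> A") (auto simp: m_def)
  have "0 < N" using s N(1) by simp
  then have p_pos: "0 < ?p" using s pos by simp
  have "real N * \<Delta> \<le> real N * (\<tau> * \<Delta>)" using pos by (intro mult_left_mono) auto
  then have "real N * \<Delta> \<le> 12 * real s"
    using N(3) mult_right_mono[of pi 12 "real s"] pi_less_4 by linarith
  \<comment> \<open>This is what allows the exponent to be raised from the actual size of the cluster to \<open>l - 1\<close>.\<close>
  then have p_le: "?p \<le> 1" using s by simp
  have "?p ^ (l - 1) * (1 / 2) ^ s \<le> (\<Prod>y\<in>A \<union> B. cmod (cis (real (m y) * d y) - 1) / 2)"
  proof (rule prod_ge_split)
    fix y assume "y \<in> A"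
    then show "?p \<le> cmod (cis (real (m y) * d y) - 1) / 2" using gapA by (simp add: m_def)
  next
    fix y assume "y \<in> B"
    then show "1 / 2 \<le> cmod (cis (real (m y) * d y) - 1) / 2"
      using mB AB(2) by (auto simp: m_def)
  qed (use AB(2-4) cardA cardB p_pos p_le in auto)
  then have "?p ^ (l - 1) * (1 / 2) ^ s
      \<le> (\<Prod>y\<in>{..<s} - {t}. cmod (cis (real (m y) * \<bar>xi ! t - xi ! y\<bar>) - 1) / 2)"
    by (simp only: AB(1) d_def)
  with budget show ?thesis by (intro exI[of _ m] conjI ballI)
qed

theorem corollary3p6:
  fixes s :: nat
  assumes "s \<ge> 2"
  shows "\<exists>C::real. C > 0 \<and>
    (\<forall>(\<Delta>::real) (\<rho>::real) (l::nat) (\<tau>::real) (xi::real list) (N::nat).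
       \<Delta> > 0 \<longrightarrow> \<rho> \<ge> 0 \<longrightarrow> 2 \<le> l \<longrightarrow> l \<le> s \<longrightarrow>
       real l - 1 \<le> \<tau> \<longrightarrow> \<tau> < pi / \<Delta> \<longrightarrow>
       4 * \<tau> * \<Delta> \<le> min \<rho> (1 / real s ^ 2) \<longrightarrow>
       set xi \<subseteq> {- (pi / 2) / real s ^ 2 <.. (pi / 2) / real s ^ 2} \<longrightarrow>
       clustered_configuration \<Delta> \<rho> s l \<tau> xi \<longrightarrow>
       max (4 * pi * real s / \<rho>) (4 * real s ^ 3) \<le> real N \<longrightarrow>
       real N \<le> pi * real s / (\<tau> * \<Delta>) \<longrightarrow>
       sigma_min (vandermonde N xi) \<ge> C * (real N * \<Delta>) ^ (l - 1))"
proof -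
  \<comment> \<open>The powers of \<open>2\<close> and \<open>12 s\<close> bound the losses at the \<open>s\<close> far and \<open>l - 1 \<le> s\<close> near nodes.\<close>
  define C where "C = 1 / (2 ^ s * (12 * real s) ^ s * sqrt (2 * real s))"
  have "C > 0" using assms by (simp add: C_def)
  moreover have "C * (real N * \<Delta>) ^ (l - 1) \<le> sigma_min (vandermonde N xi)"
    if pos: "\<Delta> > 0" and l: "2 \<le> l" "l \<le> s" and \<tau>: "real l - 1 \<le> \<tau>"
      and sep: "4 * \<tau> * \<Delta> \<le> min \<rho> (1 / real s ^ 2)"
      and small: "set xi \<subseteq> {- (pi / 2) / real s ^ 2 <.. (pi / 2) / real s ^ 2}"
      and conf: "clustered_configuration \<Delta> \<rho> s l \<tau> xi"
      and N_ge: "max (4 * pi * real s / \<rho>) (4 * real s ^ 3) \<le> real N"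
      and N_le: "real N \<le> pi * real s / (\<tau> * \<Delta>)"
    for \<Delta> \<rho> \<tau> :: real and l N :: nat and xi :: "real list"
  proof -
    have "1 \<le> \<tau>" using l \<tau> by linarith
    then have "0 < \<tau> * \<Delta>" using pos by simp
    \<comment> \<open>Division by zero does no harm: the separation condition forces \<open>\<rho>\<close> to be positive.\<close>
    then have "0 < \<rho>" using sep by simp
    have N_far: "4 * pi * real s \<le> real N * \<rho>" using N_ge \<open>0 < \<rho>\<close> by (simp add: pos_divide_le_eq)
    have N_near: "real N * (\<tau> * \<Delta>) \<le> pi * real s"
      using N_le \<open>0 < \<tau> * \<Delta>\<close> by (simp add: pos_le_divide_eq)
    have "real s * 1 \<le> real s * real s ^ 2"
      using assms by (intro mult_left_mono one_le_power) auto
    then have "2 * real s \<le> real N"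
      using N_ge by (simp add: power3_eq_cube power2_eq_square)
    then have "2 * s \<le> N" by linarith
    let ?x = "real N * \<Delta>"
    let ?P = "(?x / (12 * real s)) ^ (l - 1) * (1 / 2) ^ s"
    have len: "length xi = s" using conf by (simp add: clustered_configuration_def)
    have "?P / sqrt (2 * real s) \<le> sigma_min (vandermonde N xi)"
    proof (rule sigma_min_vandermonde_ge[OF len])
      show "0 < s" "0 < N" using assms \<open>2 * s \<le> N\<close> by auto
      show "0 \<le> ?P" using pos by simp
      fix t assume "t < s"
      then show "\<exists>m. (\<forall>y\<in>{..<s} - {t}. m y * s \<le> N) \<and>
          ?P \<le> (\<Prod>y\<in>{..<s} - {t}. cmod (cis (real (m y) * \<bar>xi ! t - xi ! y\<bar>) - 1) / 2)"
        by (rule clustered_node_gaps[OF conf small assms pos \<open>0 < \<rho>\<close> \<open>1 \<le> \<tau>\<close>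
              \<open>2 * s \<le> N\<close> N_far N_near])
    qed
    moreover have "C * ?x ^ (l - 1) \<le> ?P / sqrt (2 * real s)"
    proof -
      have "(12 * real s) ^ (l - 1) \<le> (12 * real s) ^ s"
        using assms l by (intro power_increasing) auto
      then have "?x ^ (l - 1) / (12 * real s) ^ s \<le> ?x ^ (l - 1) / (12 * real s) ^ (l - 1)"
        using assms pos by (intro divide_left_mono) auto
      then have "?x ^ (l - 1) / (12 * real s) ^ s * ((1 / 2) ^ s / sqrt (2 * real s))
          \<le> ?x ^ (l - 1) / (12 * real s) ^ (l - 1) * ((1 / 2) ^ s / sqrt (2 * real s))"
        by (intro mult_right_mono) auto
      then show ?thesis by (simp add: C_def power_divide mult_ac)
    qed
    ultimately show ?thesis by linarith
  qed
  ultimately show ?thesis by blast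
qed

end
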